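(* Let $\theta_1\in\mathbb{R}$ and $z_1=e^{i\theta_1}$. For every strictly positive integer $n$ there exists an inner analytic function $w_{\delta^{n\prime}}(z,z_1)$ whose real part, in the $\rho\to1_{(-)}$ limit, converges to $\delta^{n\prime}(\theta-\theta_1)$, the $n$-th derivative of the Dirac delta "function". That is, writing $z=\rho e^{i\theta}$ and denoting by $U_n(\rho,\theta)$ the real part of $w_{\delta^{n\prime}}(z,z_1)$, the following two conditions hold. 1. For every $\theta\not\equiv\theta_1\pmod{2\pi}$, $\lim_{\rho\to1_{(-)}}U_n(\rho,\theta)=0$. 2. For every integrable real function $g(\theta)$ on the unit circle that is differentiable to the $n$-th order and is such that the $n$-th angular derivative $w_\gamma^{(n)}(z)$ of its corresponding inner analytic function $w_\gamma(z)$ has a finite limit as $z\to z_1$ from within the open unit disk, and for every open interval $(a,b)$ of the unit circle containing $\theta_1$, $$\lim_{\rho\to1_{(-)}}\int_a^b g(\theta)\,U_n(\rho,\theta)\,d\theta=(-1)^n\,\frac{d^ng}{d\theta^n}(\theta_1).$$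
   Context: An inner analytic function is a complex function that is analytic in the open unit disk $\{|z|<1\}$. Real functions on the unit circle are $2\pi$-periodic functions of the angle $\theta$; an open interval $(a,b)$ of the unit circle containing $\theta_1$ means $a<\theta_1<b$ with $b-a\le2\pi$. The notation $\rho\to1_{(-)}$ means that $\rho$ tends to $1$ from below. The inner analytic function corresponding to an integrable real function $g$ on the unit circle is $$w_\gamma(z)=\sum_{k=0}^{\infty}c_kz^k,\qquad c_0=\frac{\alpha_0}{2},\quad c_k=\alpha_k-i\beta_k\ (k\ge1),$$ where $\alpha_k=\frac1\pi\int_{-\pi}^{\pi}g(\theta)\cos(k\theta)\,d\theta$ and $\beta_k=\frac1\pi\int_{-\pi}^{\pi}g(\theta)\sin(k\theta)\,d\theta$. The angular derivative of an inner analytic function $w(z)$ is the inner analytic function $i\,z\,\frac{dw}{dz}(z)$; the $n$-th angular derivative $w^{(n)}(z)$ is the result of applying this operation $n$ times. The symbol $\delta^{n\prime}(\theta-\theta_1)$ denotes a limiting process (here $\rho\to1_{(-)}$) satisfying the two conditions listed; an integral containing $\delta^{n\prime}(\theta-\theta_1)$ is understood as the limit of the integrals with $\delta^{n\prime}(\theta-\theta_1)$ replaced by $U_n(\rho,\theta)$. *)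

theory Defs
  imports "HOL-Complex_Analysis.Complex_Analysis" "HOL-Library.Real_Mod"
begin

definition inner_analytic :: "(complex \<Rightarrow> complex) \<Rightarrow> bool" where
  "inner_analytic w \<longleftrightarrow> w analytic_on ball 0 1"

text \<open>
  Real functions on the unit circle are represented by \<open>2\<pi>\<close>-periodic functions of the angle.
  Integrability is Lebesgue integrability over one period.
\<close>

definition integrable_on_circle :: "(real \<Rightarrow> real) \<Rightarrow> bool" where
  "integrable_on_circle g \<longleftrightarrow>
     (\<forall>\<theta>. g (\<theta> + 2 * pi) = g \<theta>) \<and> set_integrable lebesgue {- pi..pi} g"

definition n_times_differentiable :: "nat \<Rightarrow> (real \<Rightarrow> real) \<Rightarrow> bool" where
  "n_times_differentiable n g \<longleftrightarrow> (\<forall>k<n. \<forall>\<theta>. (deriv ^^ k) g differentiable (at \<theta>))"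

definition fourier_alpha :: "(real \<Rightarrow> real) \<Rightarrow> nat \<Rightarrow> real" where
  "fourier_alpha g k = 1 / pi * (LINT \<theta>:{- pi..pi}|lebesgue. g \<theta> * cos (real k * \<theta>))"

definition fourier_beta :: "(real \<Rightarrow> real) \<Rightarrow> nat \<Rightarrow> real" where
  "fourier_beta g k = 1 / pi * (LINT \<theta>:{- pi..pi}|lebesgue. g \<theta> * sin (real k * \<theta>))"

definition taylor_coeff :: "(real \<Rightarrow> real) \<Rightarrow> nat \<Rightarrow> complex" where
  "taylor_coeff g k =
     (if k = 0 then of_real (fourier_alpha g 0 / 2)
      else of_real (fourier_alpha g k) - \<i> * of_real (fourier_beta g k))"

text \<open>The values below are meaningful only for \<open>norm z < 1\<close>, where the series converges.\<close>

definition inner_fun :: "(real \<Rightarrow> real) \<Rightarrow> complex \<Rightarrow> complex" where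
  "inner_fun g z = (\<Sum>k. taylor_coeff g k * z ^ k)"

definition angular_deriv :: "(complex \<Rightarrow> complex) \<Rightarrow> complex \<Rightarrow> complex" where
  "angular_deriv w z = \<i> * z * deriv w z"

text \<open>
  \<open>U \<rho> \<theta>\<close>, as \<open>\<rho>\<close> tends to \<open>1\<close> from below, represents the \<open>n\<close>-th derivative of the Dirac delta
  at \<open>\<theta>\<^sub>1\<close>.
\<close>

definition tends_to_delta_deriv :: "nat \<Rightarrow> real \<Rightarrow> (real \<Rightarrow> real \<Rightarrow> real) \<Rightarrow> bool" where
  "tends_to_delta_deriv n \<theta>\<^sub>1 U \<longleftrightarrow>
     (\<forall>\<theta>. \<not> [\<theta> = \<theta>\<^sub>1] (rmod (2 * pi)) \<longrightarrow> ((\<lambda>\<rho>. U \<rho> \<theta>) \<longlongrightarrow> 0) (at_left 1)) \<and>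
     (\<forall>g. integrable_on_circle g \<and> n_times_differentiable n g \<and>
          (\<exists>L. ((angular_deriv ^^ n) (inner_fun g) \<longlongrightarrow> L) (at (cis \<theta>\<^sub>1) within ball 0 1)) \<longrightarrow>
       (\<forall>a b. a < \<theta>\<^sub>1 \<and> \<theta>\<^sub>1 < b \<and> b - a \<le> 2 * pi \<longrightarrow>
         ((\<lambda>\<rho>. LINT \<theta>:{a<..<b}|lebesgue. g \<theta> * U \<rho> \<theta>)
            \<longlongrightarrow> (- 1) ^ n * (deriv ^^ n) g \<theta>\<^sub>1) (at_left 1)))"

end

theory Submission
  imports Defs
begin

text \<open>
  It suffices to treat \<open>\<theta>\<^sub>1 = 0\<close> and to rotate afterwards. Write \<open>a = 1 / (1 - z)\<close>. The function
  \<open>w\<^sub>0 = (a - 1/2) / \<pi>\<close> has the Poisson kernel (of total mass 1) as its real part, so its \<open>n\<close>-th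
  angular derivative \<open>w\<^sub>n\<close> has as real part the \<open>n\<close>-th angular derivative \<open>U\<^sub>n\<close> of the Poisson kernel.
  Since the angular derivative of \<open>a\<close> is \<open>\<i> (a\<^sup>2 - a)\<close>, every \<open>w\<^sub>n\<close> is a polynomial \<open>p\<^sub>n\<close> of degree
  \<open>n + 1\<close> in \<open>a\<close>, which makes it analytic in the disk and continuous up to every boundary point
  other than \<open>1\<close>.

  The key is a reflection symmetry: \<open>z \<mapsto> 1 / cnj z\<close> acts on \<open>a\<close> as \<open>a \<mapsto> 1 - cnj a\<close>, and
  \<open>cnj (p\<^sub>n (1 - cnj a)) = - p\<^sub>n a\<close> (\<open>delta_poly_reflect\<close>). Hence \<open>U\<^sub>n\<close> vanishes on the unit circle off
  \<open>1\<close>, which is the first condition. Inside the disk, \<open>2 U\<^sub>n = Re (p\<^sub>n a - p\<^sub>n (1 - cnj a))\<close>, where the two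
  arguments are only \<open>2 \<pi> U\<^sub>0\<close> apart, so that the mean value inequality gives
  \<open>\<bar>U\<^sub>n\<bar> \<le> C U\<^sub>0 / \<bar>1 - z\<bar>\<^sup>n\<close> (\<open>poisson_deriv_bound\<close>). The trivial bound
  \<open>C / \<bar>1 - z\<bar>\<^sup>n\<^sup>+\<^sup>1\<close> would lead to the divergent integral of \<open>1 / \<bar>\<theta>\<bar>\<close> in the argument of Fatou that
  follows; here the bounded mass of \<open>U\<^sub>0\<close> takes its place.

  For the second condition, split \<open>g\<close> into its Taylor polynomial of degree \<open>n\<close> at \<open>\<theta>\<^sub>1\<close> and a remainder
  \<open>R\<close> with \<open>R \<theta> = o(\<bar>\<theta> - \<theta>\<^sub>1\<bar>\<^sup>n)\<close>; such an expansion with Peano remainder only needs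
  the derivatives to exist (\<open>taylor_peano\<close>). Repeated integration by parts evaluates the limits of the
  moments \<open>\<integral> (\<theta> - \<theta>\<^sub>1)\<^sup>k U\<^sub>n\<close> (\<open>moment_poisson_deriv\<close>): they vanish for \<open>k < n\<close> and equal
  \<open>(-1)\<^sup>n n!\<close> for \<open>k = n\<close>, so the polynomial contributes \<open>(-1)\<^sup>n g\<^sup>(\<^sup>n\<^sup>)(\<theta>\<^sub>1)\<close>. The remainder contributes
  nothing (\<open>poisson_deriv_negligible\<close>): near \<open>\<theta>\<^sub>1\<close>, where \<open>\<bar>\<theta> - \<theta>\<^sub>1\<bar> \<le> 2 \<bar>1 - z\<bar>\<close>, the bound
  turns \<open>\<bar>R U\<^sub>n\<bar>\<close> into a small multiple of \<open>U\<^sub>0\<close>, and elsewhere \<open>U\<^sub>n\<close> tends to \<open>0\<close> uniformly.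
\<close>

section \<open>Angular derivatives of the Poisson kernel\<close>

text \<open>
  Evaluated at \<open>a = 1 / (1 - z)\<close>, these polynomials are the successive angular derivatives of
  \<open>(1 + z) / (2 \<pi> (1 - z))\<close>; the recursion is the chain rule with \<open>\<i> z da/dz = \<i> (a\<^sup>2 - a)\<close>.
\<close>

primrec delta_poly :: "nat \<Rightarrow> complex poly" where
  "delta_poly 0 = [:- 1 / (2 * of_real pi), 1 / of_real pi:]"
| "delta_poly (Suc n) = smult \<i> ([:0, - 1, 1:] * pderiv (delta_poly n))"

definition poisson_deriv :: "nat \<Rightarrow> real \<Rightarrow> real \<Rightarrow> real" where
  "poisson_deriv n \<rho> t = Re (poly (delta_poly n) (1 / (1 - of_real \<rho> * cis t)))"

lemma one_minus_nonzero:
  assumes "0 \<le> \<rho>" "\<rho> < 1"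
  shows "1 - complex_of_real \<rho> * cis t \<noteq> 0"
proof
  assume "1 - complex_of_real \<rho> * cis t = 0"
  then have "norm (complex_of_real \<rho> * cis t) = 1" by simp
  then show False using assms by (simp add: norm_mult)
qed

lemma has_vector_derivative_circle:
  "((\<lambda>t. of_real \<rho> * cis t) has_vector_derivative of_real \<rho> * (\<i> * cis t)) (at t within S)"
proof -
  have cis: "(cis has_vector_derivative \<i> * cis t) (at t within S)"
    unfolding has_vector_derivative_def
    by (rule derivative_eq_intros refl | simp add: algebra_simps)+
  then show ?thesis by (rule has_vector_derivative_mult_right)
qed

lemma has_derivative_poisson_deriv:
  assumes "0 \<le> \<rho>" "\<rho> < 1"
  shows "(poisson_deriv n \<rho> has_real_derivative poisson_deriv (Suc n) \<rho> t) (at t within S)"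
proof -
  let ?z = "\<lambda>t. of_real \<rho> * cis t"
  let ?a = "1 / (1 - ?z t)"
  have nz: "1 - ?z t \<noteq> 0" using one_minus_nonzero[OF assms] .
  note z = has_vector_derivative_circle[of \<rho> t S]
  have p: "((\<lambda>z. poly (delta_poly n) (1 / (1 - z))) has_field_derivative
       (poly (pderiv (delta_poly n)) ?a * (1 / (1 - ?z t)\<^sup>2))) (at (?z t))"
    using nz by (auto intro!: derivative_eq_intros DERIV_chain2[OF poly_DERIV]
        simp: power2_eq_square)
  have "((\<lambda>t. poly (delta_poly n) (1 / (1 - ?z t))) has_vector_derivative
       (of_real \<rho> * (\<i> * cis t)) * (poly (pderiv (delta_poly n)) ?a * (1 / (1 - ?z t)\<^sup>2)))
       (at t within S)"
    using field_vector_diff_chain_within[OF z has_field_derivative_at_within[OF p]]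
    by (simp add: o_def)
  moreover have "(of_real \<rho> * (\<i> * cis t)) * (poly (pderiv (delta_poly n)) ?a * (1 / (1 - ?z t)\<^sup>2))
      = poly (delta_poly (Suc n)) ?a"
    using nz by (simp add: field_simps power2_eq_square)
  ultimately show ?thesis
    unfolding poisson_deriv_def
    by (auto simp: has_real_derivative_iff_has_vector_derivative has_vector_derivative_complex_iff)
qed

section \<open>Reflection in the unit circle and the size of the kernels\<close>

text \<open>
  Reflection \<open>z \<mapsto> 1 / cnj z\<close> turns \<open>a\<close> into \<open>1 - cnj a\<close>. The identity says that each kernel is odd under
  reflection, and it survives differentiation along the circle: the factor \<open>a\<^sup>2 - a\<close> goes to its
  conjugate, and the sign from differentiating \<open>1 - cnj a\<close> is compensated by \<open>cnj \<i> = - \<i>\<close>.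
\<close>

lemma delta_poly_reflect:
  "cnj (poly (delta_poly n) (1 - cnj x)) = - poly (delta_poly n) x"
proof (induction n arbitrary: x)
  case 0
  show ?case by (simp add: field_simps)
next
  case (Suc n)
  let ?p = "poly (delta_poly n)" and ?d = "poly (pderiv (delta_poly n))"
  have "((\<lambda>z. ?p (1 - z)) has_field_derivative - ?d (1 - cnj x)) (at (cnj x))"
    by (auto intro!: derivative_eq_intros DERIV_chain2[OF poly_DERIV])
  then have "(cnj \<circ> (\<lambda>z. ?p (1 - z)) \<circ> cnj has_field_derivative cnj (- ?d (1 - cnj x))) (at x)"
    by (rule has_field_derivative_cnj_cnj)
  moreover have "cnj \<circ> (\<lambda>z. ?p (1 - z)) \<circ> cnj = (\<lambda>z. - ?p z)"
    using Suc by (auto simp: o_def)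
  moreover have "((\<lambda>z. - ?p z) has_field_derivative - ?d x) (at x)"
    by (auto intro!: derivative_eq_intros)
  ultimately have "cnj (?d (1 - cnj x)) = ?d x"
    using DERIV_unique by fastforce
  then show ?case by (simp add: algebra_simps)
qed

lemma degree_delta_poly: "degree (delta_poly n) \<le> Suc n"
proof (induction n)
  case (Suc n)
  have "degree ([:0, - 1, 1:] * pderiv (delta_poly n)) \<le> 2 + degree (pderiv (delta_poly n))"
    by (rule order_trans[OF degree_mult_le]) simp
  then show ?case using Suc by (simp add: degree_pderiv del: mult_pCons_left)
qed simp

text \<open>
  The condition \<open>1 \<le> r\<close> allows all lower powers of \<open>r\<close> to be absorbed into \<open>r ^ m\<close>.
\<close>

lemma norm_poly_le_power:
  fixes p :: "'a::real_normed_field poly"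
  assumes "degree p \<le> m"
  shows "\<exists>C\<ge>0. \<forall>x r. norm x \<le> r \<and> 1 \<le> r \<longrightarrow> norm (poly p x) \<le> C * r ^ m"
proof (intro exI conjI allI impI)
  show "0 \<le> (\<Sum>i\<le>degree p. norm (coeff p i))" by (simp add: sum_nonneg)
next
  fix x :: 'a and r :: real
  assume r: "norm x \<le> r \<and> 1 \<le> r"
  have "norm (poly p x) \<le> (\<Sum>i\<le>degree p. norm (coeff p i) * norm x ^ i)"
    unfolding poly_altdef by (rule order_trans[OF norm_sum]) (simp add: norm_mult norm_power)
  also have "\<dots> \<le> (\<Sum>i\<le>degree p. norm (coeff p i) * r ^ m)"
  proof (intro sum_mono mult_left_mono)
    fix i assume "i \<in> {..degree p}"
    then have "norm x ^ i \<le> r ^ i" "r ^ i \<le> r ^ m"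
      using r assms by (auto intro: power_mono power_increasing)
    then show "norm x ^ i \<le> r ^ m" by simp
  qed simp
  finally show "norm (poly p x) \<le> (\<Sum>i\<le>degree p. norm (coeff p i)) * r ^ m"
    by (simp add: sum_distrib_right)
qed

lemma norm_one_minus_squared:
  "(norm (1 - complex_of_real \<rho> * cis t))\<^sup>2 = 1 - 2 * \<rho> * cos t + \<rho>\<^sup>2"
proof -
  have "(norm (1 - complex_of_real \<rho> * cis t))\<^sup>2 = 1 - 2 * \<rho> * cos t + \<rho>\<^sup>2 * ((sin t)\<^sup>2 + (cos t)\<^sup>2)"
    unfolding cmod_power2 by (simp add: power2_eq_square algebra_simps
        del: sin_cos_squared_add sin_cos_squared_add2 sin_cos_squared_add3)
  then show ?thesis by simp
qed

lemma poisson_deriv_0_eq_Re: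
  "poisson_deriv 0 \<rho> t = Re (1 / (1 - of_real \<rho> * cis t)) / pi - 1 / (2 * pi)"
proof -
  have "poly (delta_poly 0) a = of_real (1 / pi) * a - of_real (1 / (2 * pi))" for a
    by (simp add: field_simps)
  then have "Re (poly (delta_poly 0) a) = Re a / pi - 1 / (2 * pi)" for a
    by (simp only: minus_complex.simps times_complex.simps Re_complex_of_real Im_complex_of_real) simp
  then show ?thesis unfolding poisson_deriv_def .
qed

lemma poisson_deriv_0:
  assumes "0 \<le> \<rho>" "\<rho> < 1"
  shows "poisson_deriv 0 \<rho> t = (1 - \<rho>\<^sup>2) / (2 * pi * (norm (1 - of_real \<rho> * cis t))\<^sup>2)"
proof -
  let ?z = "of_real \<rho> * cis t" and ?D = "norm (1 - of_real \<rho> * cis t)"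
  have D: "?D \<noteq> 0" using one_minus_nonzero[OF assms] by simp
  have sq: "?D\<^sup>2 = 1 - 2 * \<rho> * cos t + \<rho>\<^sup>2" by (rule norm_one_minus_squared)
  have "Re (1 / (1 - ?z)) = (1 - \<rho> * cos t) / ?D\<^sup>2"
    by (simp add: Re_divide cmod_power2)
  moreover note poisson_deriv_0_eq_Re[of \<rho> t]
  moreover have "r / q / pi - 1 / (2 * pi) = (2 * r - q) / (2 * pi * q)" if "q \<noteq> 0" for r q
    using that by (simp add: field_simps)
  ultimately have "poisson_deriv 0 \<rho> t = (2 * (1 - \<rho> * cos t) - ?D\<^sup>2) / (2 * pi * ?D\<^sup>2)"
    using D by simp
  then show ?thesis by (simp add: sq)
qed

text \<open>
  By reflection, \<open>2 U\<^sub>n\<close> is the real part of the difference of \<open>p\<^sub>n\<close> at \<open>a\<close> and at \<open>1 - cnj a\<close>. These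
  points differ by \<open>2 Re a - 1 = 2 \<pi> U\<^sub>0\<close>, and on the disk containing them the derivative of \<open>p\<^sub>n\<close>, of
  degree at most \<open>n\<close>, is of size \<open>\<bar>a\<bar>\<^sup>n\<close>.
\<close>

lemma poisson_deriv_bound:
  "\<exists>C\<ge>0. \<forall>\<rho> t. 0 \<le> \<rho> \<and> \<rho> < 1 \<longrightarrow>
     \<bar>poisson_deriv n \<rho> t\<bar> \<le> C * poisson_deriv 0 \<rho> t / norm (1 - of_real \<rho> * cis t) ^ n"
proof -
  let ?p = "delta_poly n"
  have deg: "degree (pderiv ?p) \<le> n"
    using degree_delta_poly[of n] by (simp add: degree_pderiv)
  obtain C where C: "C \<ge> 0" "\<And>x r. norm x \<le> r \<Longrightarrow> 1 \<le> r \<Longrightarrow> norm (poly (pderiv ?p) x) \<le> C * r ^ n"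
    using norm_poly_le_power[OF deg] by blast
  show ?thesis
  proof (intro exI[of _ "C * 3 ^ n * pi"] conjI allI impI)
    fix \<rho> t :: real assume \<rho>: "0 \<le> \<rho> \<and> \<rho> < 1"
    define a where "a = 1 / (1 - of_real \<rho> * cis t)"
    define D where "D = norm (1 - of_real \<rho> * cis t)"
    have D: "D > 0" using one_minus_nonzero[of \<rho> t] \<rho> by (simp add: D_def)
    have aD: "norm a = 1 / D" by (simp add: a_def D_def norm_divide)
    have "D \<le> 2" unfolding D_def
      by (rule order_trans[OF norm_triangle_ineq4]) (use \<rho> in \<open>simp add: norm_mult\<close>)
    then have a: "norm a \<ge> 1/2" using D by (simp add: aD field_simps)
    have "norm (1 - cnj a) \<le> 1 + norm a"
      using norm_triangle_ineq4[of 1 "cnj a"] by simp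
    then have r: "norm (1 - cnj a) \<le> 3 * norm a" "1 \<le> 3 * norm a" "norm a \<le> 3 * norm a" using a by auto
    (* In the disk, a stays away from 0, so 3 |a| is at least 1 and at least the norm of 1 - cnj a. *)
    have "norm (poly ?p a - poly ?p (1 - cnj a)) \<le> (C * (3 * norm a) ^ n) * norm (a - (1 - cnj a))"
      by (rule field_differentiable_bound[of "cball 0 (3 * norm a)" _ "poly (pderiv ?p)"])
         (use r C(2)[of _ "3 * norm a"] in \<open>auto intro: DERIV_subset[OF poly_DERIV]\<close>)
    moreover have "2 * poisson_deriv n \<rho> t = Re (poly ?p a - poly ?p (1 - cnj a))"
      using arg_cong[OF delta_poly_reflect[of n "1 - cnj a"], of Re]
      by (simp add: poisson_deriv_def a_def)
    moreover have "a - (1 - cnj a) = of_real (2 * pi * poisson_deriv 0 \<rho> t)"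
      unfolding poisson_deriv_0_eq_Re a_def[symmetric]
      by (simp add: complex_eq_iff right_diff_distrib)
    ultimately have "2 * \<bar>poisson_deriv n \<rho> t\<bar> \<le> (C * (3 * norm a) ^ n) * \<bar>2 * pi * poisson_deriv 0 \<rho> t\<bar>"
      by (metis abs_Re_le_cmod abs_mult abs_numeral norm_of_real order_trans)
    moreover have "poisson_deriv 0 \<rho> t \<ge> 0"
      using \<rho> by (auto simp: poisson_deriv_0 power_le_one intro!: divide_nonneg_nonneg)
    ultimately show "\<bar>poisson_deriv n \<rho> t\<bar> \<le> C * 3 ^ n * pi * poisson_deriv 0 \<rho> t / norm (1 - of_real \<rho> * cis t) ^ n"
      unfolding D_def[symmetric] using D by (simp add: aD power_divide power_mult_distrib field_simps abs_mult)
  qed (use C in simp)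
qed

text \<open>
  On the unit circle \<open>1 - cnj a = a\<close>, so that reflection forces the boundary value, which exists by
  continuity, to be \<open>0\<close>.
\<close>

lemma poisson_deriv_tendsto_0:
  assumes "cis t \<noteq> 1"
  shows "((\<lambda>\<rho>. poisson_deriv n \<rho> t) \<longlongrightarrow> 0) (at_left 1)"
proof -
  have "((\<lambda>\<rho>. poisson_deriv n \<rho> t) \<longlongrightarrow> poisson_deriv n 1 t) (at_left 1)"
    unfolding poisson_deriv_def by (intro tendsto_intros) (use assms in simp)
  moreover have "cnj (1 / (1 - cis t)) = 1 - 1 / (1 - cis t)"
    using assms by (simp add: cis_cnj cis_inverse[symmetric] field_simps)
  then have "poisson_deriv n 1 t = 0"
    using arg_cong[OF delta_poly_reflect[of n "1 / (1 - cis t)"], of Re]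
    by (simp add: poisson_deriv_def)
  ultimately show ?thesis by simp
qed

lemma abs_sin_le_norm: "\<bar>sin t\<bar> \<le> norm (1 - complex_of_real \<rho> * cis t)"
proof -
  have "(sin t)\<^sup>2 \<le> (\<rho> - cos t)\<^sup>2 + (sin t)\<^sup>2" by simp
  also have "\<dots> = (norm (1 - complex_of_real \<rho> * cis t))\<^sup>2"
    unfolding norm_one_minus_squared sin_squared_eq by (simp add: power2_diff)
  finally show ?thesis
    by (metis abs_le_square_iff abs_norm_cancel)
qed

text \<open>
  Both constraints on \<open>\<bar>t\<bar>\<close> matter, since the kernels are singular at all multiples of \<open>2 \<pi>\<close>. For fixed
  \<open>\<rho>\<close> the norm is a nondecreasing function of the distance of \<open>t\<close> from these multiples.
\<close>

lemma sin_le_norm_of_far: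
  assumes "0 \<le> \<rho>" "0 < \<eta>" "\<eta> < pi" "\<eta> \<le> \<bar>t\<bar>" "\<bar>t\<bar> \<le> 2 * pi - \<eta>"
  shows "sin \<eta> \<le> norm (1 - complex_of_real \<rho> * cis t)"
proof -
  have "cos \<bar>t\<bar> \<le> cos \<eta>"
  proof (cases "\<bar>t\<bar> \<le> pi")
    case True
    then show ?thesis using assms by (intro cos_monotone_0_pi_le) auto
  next
    case False
    then have "cos (2 * pi - \<bar>t\<bar>) \<le> cos \<eta>"
      using assms by (intro cos_monotone_0_pi_le) auto
    then show ?thesis by (simp add: cos_diff)
  qed
  then have "\<rho> * cos t \<le> \<rho> * cos \<eta>"
    using \<open>0 \<le> \<rho>\<close> by (simp add: mult_left_mono)
  then have "(norm (1 - complex_of_real \<rho> * cis \<eta>))\<^sup>2 \<le> (norm (1 - complex_of_real \<rho> * cis t))\<^sup>2"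
    unfolding norm_one_minus_squared by simp
  then have "norm (1 - complex_of_real \<rho> * cis \<eta>) \<le> norm (1 - complex_of_real \<rho> * cis t)"
    by (rule power2_le_imp_le) simp
  then show ?thesis using abs_sin_le_norm[of \<eta> \<rho>] by linarith
qed

text \<open>
  Together with \<open>abs_sin_le_norm\<close>, this compares \<open>\<bar>t\<bar>\<close> with \<open>\<bar>1 - z\<bar>\<close> near the singularity,
  uniformly in \<open>\<rho>\<close>.
\<close>

lemma half_abs_le_abs_sin: "\<exists>\<delta>>0. \<forall>t. \<bar>t\<bar> < \<delta> \<longrightarrow> \<bar>t\<bar> / 2 \<le> \<bar>sin (t::real)\<bar>"
proof -
  have "(sin has_derivative (*) 1) (at (0::real))"
    using DERIV_sin[of 0] by (simp add: has_field_derivative_def)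
  then obtain \<delta> where "\<delta> > 0" "\<forall>t. norm (t - 0) < \<delta> \<longrightarrow> norm (sin t - sin 0 - 1 * (t - 0)) \<le> 1/2 * norm (t - (0::real))"
    unfolding has_derivative_at_alt by (metis half_gt_zero zero_less_one)
  moreover have "\<bar>t\<bar> / 2 \<le> \<bar>sin t\<bar>" if "norm (sin t - sin 0 - 1 * (t - 0)) \<le> 1/2 * norm (t - 0)" for t :: real
    using that by (simp add: abs_if split: if_splits)
  ultimately show ?thesis by auto
qed

lemma cos_less_one:
  assumes "0 < \<bar>t\<bar>" "\<bar>t\<bar> < 2 * pi"
  shows "cos (t::real) < 1"
proof -
  have "sin (\<bar>t\<bar> / 2) > 0" using assms by (intro sin_gt_zero) auto
  moreover have "cos \<bar>t\<bar> = 1 - 2 * (sin (\<bar>t\<bar> / 2))\<^sup>2"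
    using cos_double_sin[of "\<bar>t\<bar> / 2"] by simp
  ultimately have "cos \<bar>t\<bar> < 1" by simp
  then show ?thesis by simp
qed

section \<open>Moments\<close>

text \<open>
  The \<open>-1\<close>-st derivative of the Poisson kernel, that is, an approximation to a step of height \<open>1\<close> at
  \<open>0\<close>. The principal logarithm is smooth here because \<open>1 - z\<close> has positive real part.
\<close>

definition poisson_step :: "real \<Rightarrow> real \<Rightarrow> real" where
  "poisson_step \<rho> t = t / (2 * pi) - Im (Ln (1 - of_real \<rho> * cis t)) / pi"

lemma has_derivative_poisson_step:
  assumes "0 \<le> \<rho>" "\<rho> < 1"
  shows "(poisson_step \<rho> has_real_derivative poisson_deriv 0 \<rho> t) (at t within S)"
proof -
  let ?z = "\<lambda>t. of_real \<rho> * cis t"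
  have nz: "1 - ?z t \<noteq> 0" using one_minus_nonzero[OF assms] .
  have "\<rho> * cos t \<le> \<rho> * 1" using assms by (intro mult_left_mono) auto
  then have slit: "1 - ?z t \<notin> \<real>\<^sub>\<le>\<^sub>0"
    using assms by (auto simp: complex_nonpos_Reals_iff)
  note z = has_vector_derivative_circle[of \<rho> t S]
  have L: "((\<lambda>z. Ln (1 - z)) has_field_derivative - 1 / (1 - ?z t)) (at (?z t))"
    using slit by (auto intro!: derivative_eq_intros simp: divide_inverse)
  have "((\<lambda>t. Ln (1 - ?z t)) has_vector_derivative
      (of_real \<rho> * (\<i> * cis t)) * (- 1 / (1 - ?z t))) (at t within S)"
    using field_vector_diff_chain_within[OF z has_field_derivative_at_within[OF L]]
    by (simp add: o_def)
  moreover have "(of_real \<rho> * (\<i> * cis t)) * (- 1 / (1 - ?z t)) = \<i> * (1 - 1 / (1 - ?z t))"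
    using nz by (simp add: field_simps)
  ultimately have "((\<lambda>t. Ln (1 - ?z t)) has_vector_derivative \<i> * (1 - 1 / (1 - ?z t))) (at t within S)"
    by (simp only:)
  from has_field_derivative_Im[OF this]
  have Im: "((\<lambda>t. Im (Ln (1 - ?z t))) has_real_derivative 1 - Re (1 / (1 - ?z t))) (at t within S)"
    by simp
  have "(poisson_step \<rho> has_real_derivative 1 / (2 * pi) - (1 - Re (1 / (1 - ?z t))) / pi) (at t within S)"
    unfolding poisson_step_def
    by (intro DERIV_diff DERIV_cdivide DERIV_ident Im)
  moreover note poisson_deriv_0_eq_Re[of \<rho> t]
  moreover have "1 / (2 * pi) - (1 - r) / pi = r / pi - 1 / (2 * pi)" for r
    by (simp add: field_simps)
  ultimately show ?thesis by simp
qed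

text \<open>
  At the boundary \<open>1 - cis t = 2 sin (t/2) cis ((t - \<pi>)/2)\<close> for \<open>0 < t < 2 \<pi>\<close>, so that the argument
  of \<open>1 - cis t\<close> cancels the linear term \<open>t / (2 \<pi>)\<close>; negative \<open>t\<close> is symmetric.
\<close>

lemma poisson_step_tendsto:
  assumes "0 < \<bar>t\<bar>" "\<bar>t\<bar> < 2 * pi"
  shows "((\<lambda>\<rho>. poisson_step \<rho> t) \<longlongrightarrow> sgn t / 2) (at_left 1)"
proof -
  have slit: "1 - cis t \<notin> \<real>\<^sub>\<le>\<^sub>0" "1 - cis t \<noteq> 0"
    using cos_less_one[OF assms] by (auto simp: complex_nonpos_Reals_iff complex_eq_iff)
  have "1 - cis t = rcis (2 * sin (\<bar>t\<bar> / 2)) ((t - sgn t * pi) / 2)"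
    using assms cos_double_sin[of "t/2"] sin_double[of "t/2"]
    by (cases "t > 0")
       (auto simp: complex_eq_iff diff_divide_distrib add_divide_distrib cos_diff cos_add
         sin_diff sin_add power2_eq_square)
  then have "Arg (1 - cis t) = (t - sgn t * pi) / 2"
    using assms by (intro Arg_unique'[where r = "2 * sin (\<bar>t\<bar> / 2)"])
      (auto intro!: sin_gt_zero simp: sgn_if)
  then have "Im (Ln (1 - cis t)) = (t - sgn t * pi) / 2"
    using slit by (simp add: Arg_eq_Im_Ln)
  then have "sgn t / 2 = t / (2 * pi) - Im (Ln (1 - of_real 1 * cis t)) / pi"
    by (simp add: field_simps)
  moreover have "((\<lambda>\<rho>. poisson_step \<rho> t) \<longlongrightarrow> t / (2 * pi) - Im (Ln (1 - of_real 1 * cis t)) / pi) (at_left 1)"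
    unfolding poisson_step_def by (intro tendsto_intros) (use slit in auto)
  ultimately show ?thesis by (simp only:)
qed

lemma has_real_derivative_translate:
  fixes x :: real
  assumes "(f has_real_derivative D) (at (\<theta> - x))"
  shows "((\<lambda>\<theta>. f (\<theta> - x)) has_real_derivative D) (at \<theta> within S)"
  using DERIV_chain2[where f = f and g = "\<lambda>\<theta>. \<theta> - x" and Db = 1 and s = S, OF assms]
  by (simp add: DERIV_diff[OF DERIV_ident DERIV_const, simplified])

lemma eventually_radius: "\<forall>\<^sub>F \<rho> in at_left 1. 0 \<le> \<rho> \<and> \<rho> < (1::real)"
  using eventually_at_left_real[of 0 "1::real"] by (auto elim: eventually_mono)

lemma continuous_on_poisson_deriv:
  assumes "0 \<le> \<rho>" "\<rho> < 1"
  shows "continuous_on S (\<lambda>\<theta>. poisson_deriv n \<rho> (\<theta> - x))"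
  by (rule DERIV_continuous_on[where D = "\<lambda>\<theta>. poisson_deriv (Suc n) \<rho> (\<theta> - x)"])
     (intro has_real_derivative_translate has_derivative_poisson_deriv assms)

text \<open>
  Integration by parts lowers \<open>k\<close> and \<open>n\<close> together; the boundary terms disappear in the limit because
  neither endpoint is congruent to \<open>x\<close> modulo \<open>2 \<pi>\<close>. The recursion ends at \<open>n = 0\<close>, where the mass of the
  Poisson kernel is the jump \<open>1/2 - (-1/2)\<close> of its antiderivative, or at \<open>k = 0\<close>, where
  only boundary terms are left.
\<close>

lemma moment_poisson_deriv:
  assumes "a < x" "x < b" "b - a \<le> 2 * pi" "k \<le> n"
  shows "((\<lambda>\<rho>. integral {a..b} (\<lambda>\<theta>. (\<theta> - x) ^ k * poisson_deriv n \<rho> (\<theta> - x)))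
           \<longlongrightarrow> (if k = n then (- 1) ^ n * fact n else 0)) (at_left 1)"
  using \<open>k \<le> n\<close>
proof (induction n arbitrary: k)
  case 0
  have "((\<lambda>\<rho>. poisson_step \<rho> (b - x) - poisson_step \<rho> (a - x)) \<longlongrightarrow> sgn (b - x) / 2 - sgn (a - x) / 2) (at_left 1)"
    using assms by (intro tendsto_diff poisson_step_tendsto) auto
  moreover have "\<forall>\<^sub>F \<rho> in at_left 1. poisson_step \<rho> (b - x) - poisson_step \<rho> (a - x) =
      integral {a..b} (\<lambda>\<theta>. (\<theta> - x) ^ k * poisson_deriv 0 \<rho> (\<theta> - x))"
    using eventually_radius
  proof eventually_elim
    case (elim \<rho>)
    have "((\<lambda>\<theta>. poisson_deriv 0 \<rho> (\<theta> - x)) has_integral poisson_step \<rho> (b - x) - poisson_step \<rho> (a - x)) {a..b}"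
      using assms elim
      by (intro fundamental_theorem_of_calculus)
         (auto simp flip: has_real_derivative_iff_has_vector_derivative
           intro!: has_real_derivative_translate has_derivative_poisson_step)
    then show ?case using 0 by (simp add: integral_unique)
  qed
  ultimately show ?case using 0 assms by (simp add: tendsto_cong)
next
  case (Suc n)
  define B where "B = (\<lambda>\<rho> \<theta>. (\<theta> - x) ^ k * poisson_deriv n \<rho> (\<theta> - x))"
  define I where "I = (\<lambda>\<rho>. integral {a..b} (\<lambda>\<theta>. (\<theta> - x) ^ (k - 1) * poisson_deriv n \<rho> (\<theta> - x)))"
  have boundary: "((\<lambda>\<rho>. B \<rho> \<theta>) \<longlongrightarrow> 0) (at_left 1)" if "\<theta> = a \<or> \<theta> = b" for \<theta>
  proof -
    have "cos (\<theta> - x) < 1" using assms that by (intro cos_less_one) auto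
    then have "cis (\<theta> - x) \<noteq> 1" by (auto simp: complex_eq_iff)
    then show ?thesis
      unfolding B_def by (intro tendsto_mult_right_zero poisson_deriv_tendsto_0)
  qed
  have "(I \<longlongrightarrow> (if k - 1 = n then (- 1) ^ n * fact n else 0)) (at_left 1)"
    (* For k = 0 the truncated k - 1 is 0, a legitimate index; its limit is then multiplied by 0. *)
    unfolding I_def using Suc.prems by (intro Suc.IH) simp
  then have "((\<lambda>\<rho>. B \<rho> b - B \<rho> a - real k * I \<rho>) \<longlongrightarrow>
      0 - 0 - real k * (if k - 1 = n then (- 1) ^ n * fact n else 0)) (at_left 1)"
    by (intro tendsto_diff tendsto_mult_left boundary) auto
  also have "0 - 0 - real k * (if k - 1 = n then (- 1) ^ n * fact n else 0) =
      (if k = Suc n then (- 1) ^ Suc n * fact (Suc n) else (0::real))"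
    using Suc.prems by (cases k) auto
  finally have lim: "((\<lambda>\<rho>. B \<rho> b - B \<rho> a - real k * I \<rho>) \<longlongrightarrow>
      (if k = Suc n then (- 1) ^ Suc n * fact (Suc n) else 0)) (at_left 1)" .
  have "\<forall>\<^sub>F \<rho> in at_left 1. B \<rho> b - B \<rho> a - real k * I \<rho> =
      integral {a..b} (\<lambda>\<theta>. (\<theta> - x) ^ k * poisson_deriv (Suc n) \<rho> (\<theta> - x))"
    using eventually_radius
  proof eventually_elim
    case (elim \<rho>)
    let ?f = "\<lambda>\<theta>. (\<theta> - x) ^ (k - 1) * poisson_deriv n \<rho> (\<theta> - x)"
    let ?g = "\<lambda>\<theta>. (\<theta> - x) ^ k * poisson_deriv (Suc n) \<rho> (\<theta> - x)"
    have int: "(\<lambda>\<theta>. real k * ?f \<theta>) integrable_on {a..b}" "?g integrable_on {a..b}"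
      using elim by (intro integrable_continuous_real continuous_intros continuous_on_poisson_deriv; simp)+
    have "((\<lambda>\<theta>. real k * ?f \<theta> + ?g \<theta>) has_integral B \<rho> b - B \<rho> a) {a..b}"
      unfolding B_def using assms elim
      by (intro fundamental_theorem_of_calculus)
         (auto simp flip: has_real_derivative_iff_has_vector_derivative
           intro!: derivative_eq_intros has_real_derivative_translate has_derivative_poisson_deriv)
    then have "B \<rho> b - B \<rho> a = integral {a..b} (\<lambda>\<theta>. real k * ?f \<theta> + ?g \<theta>)"
      by (simp add: integral_unique)
    also have "\<dots> = real k * I \<rho> + integral {a..b} ?g"
      unfolding I_def using int by (subst integral_add) auto
    finally show ?case by simp
  qed
  then show ?case using lim by (simp add: tendsto_cong)
qed

section \<open>Taylor expansion with Peano remainder\<close>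

text \<open>
  The remainder vanishes at \<open>x\<close>, and its derivative is the remainder of one order less for the derived
  family, so the estimate passes from the latter to the former by the mean value inequality. The base case is the definition of
  differentiability at \<open>x\<close>.
\<close>

lemma taylor_peano:
  fixes d :: "nat \<Rightarrow> real \<Rightarrow> real"
  assumes "\<And>k t. k \<le> n \<Longrightarrow> (d k has_real_derivative d (Suc k) t) (at t)" and "\<epsilon> > 0"
  shows "\<exists>\<delta>>0. \<forall>t. \<bar>t - x\<bar> < \<delta> \<longrightarrow>
     \<bar>d 0 t - (\<Sum>k\<le>Suc n. d k x / fact k * (t - x) ^ k)\<bar> \<le> \<epsilon> * \<bar>t - x\<bar> ^ Suc n"
  using assms(1)
proof (induction n arbitrary: d)
  case 0
  then have "(d 0 has_derivative (\<lambda>h. d 1 x * h)) (at x)"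
    by (simp add: has_field_derivative_def)
  then obtain \<delta> where "\<delta> > 0" "\<forall>t. norm (t - x) < \<delta> \<longrightarrow> norm (d 0 t - d 0 x - d 1 x * (t - x)) \<le> \<epsilon> * norm (t - x)"
    using \<open>\<epsilon> > 0\<close> unfolding has_derivative_at_alt by metis
  then show ?case by (intro exI[of _ \<delta>]) (auto simp: algebra_simps)
next
  case (Suc n)
  define R where "R = (\<lambda>t. d 0 t - (\<Sum>k\<le>Suc (Suc n). d k x / fact k * (t - x) ^ k))"
  define R' where "R' = (\<lambda>t. d (Suc 0) t - (\<Sum>k\<le>Suc n. d (Suc k) x / fact k * (t - x) ^ k))"
  obtain \<delta> where \<delta>: "\<delta> > 0" "\<And>t. \<bar>t - x\<bar> < \<delta> \<Longrightarrow> \<bar>R' t\<bar> \<le> \<epsilon> * \<bar>t - x\<bar> ^ Suc n"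
    using Suc.IH[of "\<lambda>k. d (Suc k)"] Suc.prems by (auto simp: R'_def)
  have R_eq: "R = (\<lambda>t. d 0 t - (d 0 x + (\<Sum>k\<le>Suc n. d (Suc k) x / fact (Suc k) * (t - x) ^ Suc k)))"
    unfolding R_def by (subst sum.atMost_Suc_shift) simp
  have deriv: "(R has_real_derivative R' t) (at t within S)" for t S
    unfolding R_eq R'_def
    by (rule derivative_eq_intros has_field_derivative_at_within[OF Suc.prems] refl | simp)+
       (auto simp: field_simps simp del: power_Suc intro!: sum.cong)
  have "R x = 0" unfolding R_eq by simp
  have "\<bar>R t\<bar> \<le> \<epsilon> * \<bar>t - x\<bar> ^ Suc (Suc n)" if t: "\<bar>t - x\<bar> < \<delta>" for t
  proof -
    have "norm (R t - R x) \<le> \<epsilon> * \<bar>t - x\<bar> ^ Suc n * norm (t - x)"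
    proof (rule field_differentiable_bound[of "closed_segment x t"])
      show "norm (R' s) \<le> \<epsilon> * \<bar>t - x\<bar> ^ Suc n" if "s \<in> closed_segment x t" for s
      proof -
        have s: "\<bar>s - x\<bar> \<le> \<bar>t - x\<bar>"
          using that by (auto simp: closed_segment_eq_real_ivl split: if_splits)
        then have "\<bar>R' s\<bar> \<le> \<epsilon> * \<bar>s - x\<bar> ^ Suc n" using \<delta> t by auto
        also have "\<dots> \<le> \<epsilon> * \<bar>t - x\<bar> ^ Suc n"
          using s \<open>\<epsilon> > 0\<close> by (intro mult_left_mono power_mono) auto
        finally show ?thesis by simp
      qed
    qed (auto intro: deriv)
    then show ?thesis using \<open>R x = 0\<close> by (simp add: mult_ac)
  qed
  then show ?case using \<delta>(1) unfolding R_def by blast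
qed


section \<open>The kernels as derivatives of the Dirac delta\<close>

text \<open>
  Functions that are small to order \<open>n\<close> at \<open>x\<close> are not seen by the kernel in the limit. Within distance
  \<open>\<eta>\<close> of \<open>x\<close> the smallness of \<open>R\<close> absorbs the singularity \<open>\<bar>1 - z\<bar>\<^sup>-\<^sup>n\<close> and leaves a small multiple of
  the Poisson kernel, whose mass is bounded; at larger distance \<open>\<bar>1 - z\<bar> \<ge> sin \<eta>\<close>, and the factor
  \<open>1 - \<rho>\<^sup>2\<close> in \<open>U\<^sub>0\<close> gives uniform convergence to \<open>0\<close>.
\<close>

lemma poisson_deriv_negligible:
  fixes R :: "real \<Rightarrow> real"
  assumes ab: "a < x" "x < b" "b - a \<le> 2 * pi"
    and cont: "continuous_on {a..b} R"
    and small: "\<And>\<epsilon>. \<epsilon> > 0 \<Longrightarrow> \<exists>\<delta>>0. \<forall>\<theta>. \<bar>\<theta> - x\<bar> < \<delta> \<longrightarrow> \<bar>R \<theta>\<bar> \<le> \<epsilon> * \<bar>\<theta> - x\<bar> ^ n"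
  shows "((\<lambda>\<rho>. integral {a..b} (\<lambda>\<theta>. R \<theta> * poisson_deriv n \<rho> (\<theta> - x))) \<longlongrightarrow> 0) (at_left 1)"
proof (rule tendstoI)
  fix e :: real assume "e > 0"
  obtain C where C: "C \<ge> 0" and bound: "\<And>\<rho> t. 0 \<le> \<rho> \<Longrightarrow> \<rho> < 1 \<Longrightarrow>
      \<bar>poisson_deriv n \<rho> t\<bar> \<le> C * poisson_deriv 0 \<rho> t / norm (1 - of_real \<rho> * cis t) ^ n"
    using poisson_deriv_bound[of n] by blast
  (* The part near x will contribute at most C 2^n \<epsilon> in the limit; adding 1 covers C = 0. *)
  define \<epsilon> where "\<epsilon> = e / (4 * (C * 2 ^ n + 1))"
  have "\<epsilon> > 0" using \<open>e > 0\<close> C by (auto simp: \<epsilon>_def intro!: divide_pos_pos add_nonneg_pos)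
  obtain \<delta> where \<delta>: "\<delta> > 0" "\<And>\<theta>. \<bar>\<theta> - x\<bar> < \<delta> \<Longrightarrow> \<bar>R \<theta>\<bar> \<le> \<epsilon> * \<bar>\<theta> - x\<bar> ^ n"
    using small[OF \<open>\<epsilon> > 0\<close>] by blast
  obtain \<delta>' where \<delta>': "\<delta>' > 0" "\<And>t::real. \<bar>t\<bar> < \<delta>' \<Longrightarrow> \<bar>t\<bar> / 2 \<le> \<bar>sin t\<bar>"
    using half_abs_le_abs_sin by blast
  (* As b - a is at most 2 pi, taking \<eta> below x - a and b - x also keeps all of [a, b] at distance
     at least \<eta> from the translates of x by 2 pi and - 2 pi. *)
  define \<eta> where "\<eta> = Min {\<delta>, \<delta>', x - a, b - x, 1}"
  have \<eta>: "\<eta> > 0" "\<eta> \<le> \<delta>" "\<eta> \<le> \<delta>'" "\<eta> \<le> x - a" "\<eta> \<le> b - x" "\<eta> \<le> 1"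
    using \<delta> \<delta>' ab by (auto simp: \<eta>_def)
  have "\<eta> < pi" using \<eta> pi_gt3 by linarith
  then have sin: "sin \<eta> > 0" using \<eta> by (intro sin_gt_zero) auto
  obtain M where M: "M \<ge> 0" "\<And>\<theta>. \<theta> \<in> {a..b} \<Longrightarrow> \<bar>R \<theta>\<bar> \<le> M"
    using compact_imp_bounded[OF compact_continuous_image[OF cont compact_Icc]]
    unfolding bounded_pos by (metis imageI less_imp_le real_norm_def)
  define K where "K = M * C / (2 * pi * sin \<eta> ^ (n + 2))"
  have "K \<ge> 0" using M C sin by (simp add: K_def)
  have pointwise: "\<bar>R \<theta> * poisson_deriv n \<rho> (\<theta> - x)\<bar>
      \<le> \<epsilon> * C * 2 ^ n * poisson_deriv 0 \<rho> (\<theta> - x) + K * (1 - \<rho>\<^sup>2)"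
    if \<rho>: "0 \<le> \<rho>" "\<rho> < 1" and \<theta>: "\<theta> \<in> {a..b}" for \<rho> \<theta>
  proof -
    define t where "t = \<theta> - x"
    define D where "D = norm (1 - complex_of_real \<rho> * cis t)"
    have D: "D > 0" using one_minus_nonzero[OF \<rho>] by (simp add: D_def)
    have \<rho>2: "1 - \<rho>\<^sup>2 \<ge> 0" using \<rho> by (simp add: power_le_one)
    have P: "poisson_deriv 0 \<rho> t = (1 - \<rho>\<^sup>2) / (2 * pi * D\<^sup>2)"
      using poisson_deriv_0[OF \<rho>] by (simp add: D_def)
    then have P0: "poisson_deriv 0 \<rho> t \<ge> 0" using \<rho>2 by simp
    have b: "\<bar>poisson_deriv n \<rho> t\<bar> \<le> C * poisson_deriv 0 \<rho> t / D ^ n"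
      using bound[OF \<rho>] by (simp add: D_def)
    have "\<bar>R \<theta>\<bar> * \<bar>poisson_deriv n \<rho> t\<bar> \<le> \<epsilon> * C * 2 ^ n * poisson_deriv 0 \<rho> t + K * (1 - \<rho>\<^sup>2)"
    proof (cases "\<bar>t\<bar> < \<eta>")
      case True
      then have "\<bar>t\<bar> / 2 \<le> D"
        using \<delta>'(2)[of t] abs_sin_le_norm[of t \<rho>] \<eta> unfolding D_def by linarith
      then have "(\<bar>t\<bar> / D) ^ n \<le> 2 ^ n"
        using D by (intro power_mono) (auto simp: field_simps)
      have "\<bar>R \<theta>\<bar> * \<bar>poisson_deriv n \<rho> t\<bar> \<le> (\<epsilon> * \<bar>t\<bar> ^ n) * (C * poisson_deriv 0 \<rho> t / D ^ n)"
        using \<delta>(2)[of \<theta>] True \<eta> b \<open>\<epsilon> > 0\<close> by (intro mult_mono) (auto simp: t_def)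
      also have "\<dots> = (\<epsilon> * C * poisson_deriv 0 \<rho> t) * (\<bar>t\<bar> / D) ^ n"
        by (simp add: power_divide)
      also have "\<dots> \<le> (\<epsilon> * C * poisson_deriv 0 \<rho> t) * 2 ^ n"
        using \<open>\<epsilon> > 0\<close> C P0 by (intro mult_left_mono[OF \<open>(\<bar>t\<bar> / D) ^ n \<le> 2 ^ n\<close>]) auto
      finally show ?thesis using mult_nonneg_nonneg[OF \<open>K \<ge> 0\<close> \<rho>2] by (simp add: mult_ac)
    next
      case False
      have "sin \<eta> \<le> D"
        unfolding D_def using \<rho> \<eta> \<open>\<eta> < pi\<close> False \<theta> ab
        by (intro sin_le_norm_of_far) (auto simp: t_def)
      then have "sin \<eta> ^ (n + 2) \<le> D ^ (n + 2)" using sin by (intro power_mono) auto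
      have "\<bar>R \<theta>\<bar> * \<bar>poisson_deriv n \<rho> t\<bar> \<le> M * (C * poisson_deriv 0 \<rho> t / D ^ n)"
        using M(2)[OF \<theta>] M(1) b by (intro mult_mono) auto
      also have "\<dots> = (M * C * (1 - \<rho>\<^sup>2) / (2 * pi)) / D ^ (n + 2)"
        by (simp add: P power_add power2_eq_square)
      also have "\<dots> \<le> (M * C * (1 - \<rho>\<^sup>2) / (2 * pi)) / sin \<eta> ^ (n + 2)"
        using M C \<rho>2 sin D by (intro divide_left_mono[OF \<open>sin \<eta> ^ (n + 2) \<le> D ^ (n + 2)\<close>]) auto
      also have "\<dots> = K * (1 - \<rho>\<^sup>2)" by (simp add: K_def)
      finally show ?thesis using \<open>\<epsilon> > 0\<close> C P0 by (simp add: add_increasing)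
    qed
    then show ?thesis by (simp add: abs_mult t_def)
  qed
  have mass: "((\<lambda>\<rho>. integral {a..b} (\<lambda>\<theta>. poisson_deriv 0 \<rho> (\<theta> - x))) \<longlongrightarrow> 1) (at_left 1)"
    using moment_poisson_deriv[OF ab, of 0 0] by simp
  have "((\<lambda>\<rho>. \<epsilon> * C * 2 ^ n * integral {a..b} (\<lambda>\<theta>. poisson_deriv 0 \<rho> (\<theta> - x)) + K * (1 - \<rho>\<^sup>2) * (b - a))
      \<longlongrightarrow> \<epsilon> * C * 2 ^ n * 1 + K * (1 - 1\<^sup>2) * (b - a)) (at_left 1)"
    by (intro tendsto_intros mass)
  moreover have "\<epsilon> * C * 2 ^ n * 1 + K * (1 - 1\<^sup>2) * (b - a) < e"
  proof -
    have "\<epsilon> * (C * 2 ^ n) \<le> \<epsilon> * (C * 2 ^ n + 1)" using \<open>\<epsilon> > 0\<close> by simp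
    also have "\<dots> = e / 4"
    proof -
      have "e / (4 * q) * q = e / 4" if "q > 0" for q :: real using that by simp
      moreover have "C * 2 ^ n + 1 > 0" using C by (simp add: add_nonneg_pos)
      ultimately show ?thesis unfolding \<epsilon>_def .
    qed
    finally show ?thesis using \<open>e > 0\<close> by (simp add: mult_ac)
  qed
  ultimately have "\<forall>\<^sub>F \<rho> in at_left 1. \<epsilon> * C * 2 ^ n *
      integral {a..b} (\<lambda>\<theta>. poisson_deriv 0 \<rho> (\<theta> - x)) + K * (1 - \<rho>\<^sup>2) * (b - a) < e"
    by (rule order_tendstoD)
  then show "\<forall>\<^sub>F \<rho> in at_left 1. dist (integral {a..b} (\<lambda>\<theta>. R \<theta> * poisson_deriv n \<rho> (\<theta> - x))) 0 < e"
    using eventually_radius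
  proof eventually_elim
    case (elim \<rho>)
    let ?P = "\<lambda>\<theta>. poisson_deriv 0 \<rho> (\<theta> - x)"
    have int: "(\<lambda>\<theta>. \<epsilon> * C * 2 ^ n * ?P \<theta>) integrable_on {a..b}"
      "(\<lambda>\<theta>. R \<theta> * poisson_deriv n \<rho> (\<theta> - x)) integrable_on {a..b}"
      using elim cont
      by (intro integrable_continuous_real continuous_intros continuous_on_poisson_deriv; simp)+
    have "norm (integral {a..b} (\<lambda>\<theta>. R \<theta> * poisson_deriv n \<rho> (\<theta> - x))) \<le>
        integral {a..b} (\<lambda>\<theta>. \<epsilon> * C * 2 ^ n * ?P \<theta> + K * (1 - \<rho>\<^sup>2))"
      using pointwise elim int
      by (intro integral_norm_bound_integral integrable_add integrable_const_ivl) auto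
    also have "\<dots> = \<epsilon> * C * 2 ^ n * integral {a..b} ?P + K * (1 - \<rho>\<^sup>2) * (b - a)"
      using int ab by (subst integral_add) (auto intro: integrable_const_ivl)
    finally show ?case using elim by simp
  qed
qed

text \<open>
  Only the term \<open>k = n\<close> of the Taylor polynomial survives, and there \<open>n!\<close> cancels.
\<close>

lemma poisson_deriv_reproduces:
  fixes d :: "nat \<Rightarrow> real \<Rightarrow> real"
  assumes ab: "a < x" "x < b" "b - a \<le> 2 * pi" and n: "n > 0"
    and d: "\<And>k t. k < n \<Longrightarrow> (d k has_real_derivative d (Suc k) t) (at t)"
  shows "((\<lambda>\<rho>. integral {a..b} (\<lambda>\<theta>. d 0 \<theta> * poisson_deriv n \<rho> (\<theta> - x)))
           \<longlongrightarrow> (- 1) ^ n * d n x) (at_left 1)"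
proof -
  define T where "T = (\<lambda>\<theta>. \<Sum>k\<le>n. d k x / fact k * (\<theta> - x) ^ k)"
  have cont_d: "continuous_on S (d 0)" for S
    using DERIV_isCont[OF d[OF n]] by (simp add: continuous_at_imp_continuous_on)
  have cont_T: "continuous_on S T" for S
    unfolding T_def by (intro continuous_intros)
  have "((\<lambda>\<rho>. integral {a..b} (\<lambda>\<theta>. (d 0 \<theta> - T \<theta>) * poisson_deriv n \<rho> (\<theta> - x))) \<longlongrightarrow> 0) (at_left 1)"
  proof (rule poisson_deriv_negligible[OF ab])
    show "continuous_on {a..b} (\<lambda>\<theta>. d 0 \<theta> - T \<theta>)"
      by (intro continuous_intros cont_d cont_T)
    obtain m where m: "n = Suc m" using n by (cases n) auto
    show "\<exists>\<delta>>0. \<forall>\<theta>. \<bar>\<theta> - x\<bar> < \<delta> \<longrightarrow> \<bar>d 0 \<theta> - T \<theta>\<bar> \<le> \<epsilon> * \<bar>\<theta> - x\<bar> ^ n" if "\<epsilon> > 0" for \<epsilon>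
      unfolding T_def m using d that by (intro taylor_peano) (auto simp: m)
  qed
  moreover have "((\<lambda>\<rho>. \<Sum>k\<le>n. d k x / fact k *
        integral {a..b} (\<lambda>\<theta>. (\<theta> - x) ^ k * poisson_deriv n \<rho> (\<theta> - x)))
      \<longlongrightarrow> (\<Sum>k\<le>n. d k x / fact k * (if k = n then (- 1) ^ n * fact n else 0))) (at_left 1)"
    by (intro tendsto_sum tendsto_mult_left moment_poisson_deriv[OF ab]) simp
  moreover have "(\<Sum>k\<le>n. d k x / fact k * (if k = n then (- 1) ^ n * fact n else 0)) = (- 1) ^ n * d n x"
    by (simp add: if_distrib sum.delta cong: if_cong)
  ultimately have "((\<lambda>\<rho>. integral {a..b} (\<lambda>\<theta>. (d 0 \<theta> - T \<theta>) * poisson_deriv n \<rho> (\<theta> - x)) +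
      (\<Sum>k\<le>n. d k x / fact k * integral {a..b} (\<lambda>\<theta>. (\<theta> - x) ^ k * poisson_deriv n \<rho> (\<theta> - x))))
      \<longlongrightarrow> 0 + (- 1) ^ n * d n x) (at_left 1)"
    by (intro tendsto_add) simp_all
  moreover have "\<forall>\<^sub>F \<rho> in at_left 1.
      integral {a..b} (\<lambda>\<theta>. (d 0 \<theta> - T \<theta>) * poisson_deriv n \<rho> (\<theta> - x)) +
      (\<Sum>k\<le>n. d k x / fact k * integral {a..b} (\<lambda>\<theta>. (\<theta> - x) ^ k * poisson_deriv n \<rho> (\<theta> - x)))
      = integral {a..b} (\<lambda>\<theta>. d 0 \<theta> * poisson_deriv n \<rho> (\<theta> - x))"
    using eventually_radius
  proof eventually_elim
    case (elim \<rho>)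
    let ?U = "\<lambda>\<theta>. poisson_deriv n \<rho> (\<theta> - x)"
    have U: "continuous_on {a..b} ?U" using elim by (intro continuous_on_poisson_deriv) auto
    have "(\<Sum>k\<le>n. d k x / fact k * integral {a..b} (\<lambda>\<theta>. (\<theta> - x) ^ k * ?U \<theta>))
        = integral {a..b} (\<lambda>\<theta>. \<Sum>k\<le>n. d k x / fact k * ((\<theta> - x) ^ k * ?U \<theta>))"
      by (subst integral_sum)
         (auto intro!: integrable_continuous_real continuous_intros U sum.cong simp flip: integral_mult_right)
    also have "\<dots> = integral {a..b} (\<lambda>\<theta>. T \<theta> * ?U \<theta>)"
      by (simp add: T_def sum_distrib_right mult.assoc)
    finally have polynomial_part: "(\<Sum>k\<le>n. d k x / fact k * integral {a..b} (\<lambda>\<theta>. (\<theta> - x) ^ k * ?U \<theta>))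
        = integral {a..b} (\<lambda>\<theta>. T \<theta> * ?U \<theta>)" .
    have "integral {a..b} (\<lambda>\<theta>. (d 0 \<theta> - T \<theta>) * ?U \<theta>) + integral {a..b} (\<lambda>\<theta>. T \<theta> * ?U \<theta>)
        = integral {a..b} (\<lambda>\<theta>. (d 0 \<theta> - T \<theta>) * ?U \<theta> + T \<theta> * ?U \<theta>)"
      by (intro integral_add[symmetric] integrable_continuous_real continuous_intros cont_d cont_T U)
    then show ?case unfolding polynomial_part by (simp add: left_diff_distrib)
  qed
  ultimately show ?thesis by (simp add: tendsto_cong)
qed

theorem theorem2:
  fixes \<theta>\<^sub>1 :: real and n :: nat
  assumes "n > 0"
  shows "\<exists>w. inner_analytic w \<and>
           tends_to_delta_deriv n \<theta>\<^sub>1 (\<lambda>\<rho> \<theta>. Re (w (of_real \<rho> * cis \<theta>)))"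
proof (intro exI conjI)
  (* The n-th angular derivative of the function with the Poisson kernel as real part, rotated so
     that its pole is at cis \<theta>\<^sub>1. *)
  let ?w = "\<lambda>z. poly (delta_poly n) (1 / (1 - z * cis (- \<theta>\<^sub>1)))"
  have "1 - z * cis (- \<theta>\<^sub>1) \<noteq> 0" if "z \<in> ball 0 1" for z
  proof
    assume "1 - z * cis (- \<theta>\<^sub>1) = 0"
    then have "norm (z * cis (- \<theta>\<^sub>1)) = 1" by simp
    then show False using that by (simp add: norm_mult)
  qed
  then have "?w holomorphic_on ball 0 1"
    by (intro holomorphic_intros) auto
  then show "inner_analytic ?w"
    by (simp add: inner_analytic_def analytic_on_open)
  have w: "Re (?w (of_real \<rho> * cis \<theta>)) = poisson_deriv n \<rho> (\<theta> - \<theta>\<^sub>1)" for \<rho> \<theta>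
    by (simp add: poisson_deriv_def cis_mult mult.assoc)
  show "tends_to_delta_deriv n \<theta>\<^sub>1 (\<lambda>\<rho> \<theta>. Re (?w (of_real \<rho> * cis \<theta>)))"
    unfolding tends_to_delta_deriv_def w
  proof (intro conjI allI impI, goal_cases)
    case (1 \<theta>)
    have "cis (\<theta> - \<theta>\<^sub>1) \<noteq> 1"
    proof
      assume "cis (\<theta> - \<theta>\<^sub>1) = 1"
      then have "cos (\<theta> - \<theta>\<^sub>1) = 1" by (auto simp: complex_eq_iff)
      then obtain m :: int where "\<theta> - \<theta>\<^sub>1 = of_int m * 2 * pi" by (auto simp: cos_one_2pi_int)
      then have "\<theta>\<^sub>1 = \<theta> + of_int (- m) * (2 * pi)" by simp
      then have "[\<theta> = \<theta>\<^sub>1] (rmod (2 * pi))" unfolding rcong_altdef by blast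
      then show False using 1 by simp
    qed
    then show ?case by (rule poisson_deriv_tendsto_0)
  next
    case (2 g a b)
    then have diff: "(deriv ^^ k) g differentiable (at t)" if "k < n" for k t
      using that by (simp add: n_times_differentiable_def)
    have d: "((deriv ^^ k) g has_real_derivative (deriv ^^ Suc k) g t) (at t)" if "k < n" for k t
      using diff[OF that] by (simp add: DERIV_deriv_iff_real_differentiable)
    have "((\<lambda>\<rho>. integral {a..b} (\<lambda>\<theta>. (deriv ^^ 0) g \<theta> * poisson_deriv n \<rho> (\<theta> - \<theta>\<^sub>1)))
        \<longlongrightarrow> (- 1) ^ n * (deriv ^^ n) g \<theta>\<^sub>1) (at_left 1)"
      using 2 d assms by (intro poisson_deriv_reproduces) auto
    moreover have "\<forall>\<^sub>F \<rho> in at_left 1. integral {a..b} (\<lambda>\<theta>. (deriv ^^ 0) g \<theta> * poisson_deriv n \<rho> (\<theta> - \<theta>\<^sub>1)) =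
        (LINT \<theta>:{a<..<b}|lebesgue. g \<theta> * poisson_deriv n \<rho> (\<theta> - \<theta>\<^sub>1))"
      using eventually_radius
    proof eventually_elim
      case (elim \<rho>)
      let ?f = "\<lambda>\<theta>. g \<theta> * poisson_deriv n \<rho> (\<theta> - \<theta>\<^sub>1)"
      have "continuous_on {a..b} g"
        using DERIV_isCont[OF d[OF assms]] by (simp add: continuous_at_imp_continuous_on)
      then have "continuous_on {a..b} ?f"
        using elim by (intro continuous_intros continuous_on_poisson_deriv) auto
      then have "?f absolutely_integrable_on {a..b}"
        by (rule absolutely_integrable_continuous_real)
      then have "?f absolutely_integrable_on {a<..<b}"
        by (rule set_integrable_subset) auto
      then show ?case
        using set_lebesgue_integral_eq_integral(2)[of "{a<..<b}" ?f]
        by (simp add: integral_open_interval_real)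
    qed
    ultimately show ?case by (simp add: tendsto_cong)
  qed
qed

end
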